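(* Let $(x_n)$ be a sequence taking values in a topological space $X$. Then the following are equivalent: (i) $(x_n)$ is statistically convergent; (ii) there exists a statistically convergent subsequence $(x_{n_k})$ with $\{n_k : k \in \omega\} \in \mathcal{Z}^\star$. If, in addition, $X$ is first countable, then they are also equivalent to: (iii) there exists a convergent subsequence $(x_{n_k})$ with $\{n_k : k \in \omega\} \in \mathcal{Z}^\star$.
   Context: $\omega$ denotes the set of positive integers. The upper asymptotic density of $S \subseteq \omega$ is $\mathrm{d}^\star(S) := \limsup_{n \to \infty} \frac{|S \cap [1,n]|}{n}$. Let $\mathcal{Z} := \{S \subseteq \omega : \mathrm{d}^\star(S) = 0\}$ and $\mathcal{Z}^\star := \{A \subseteq \omega : A^c \in \mathcal{Z}\}$. A sequence $(x_n)$ in $X$ is statistically convergent to $\ell \in X$ if $\{n : x_n \in U\} \in \mathcal{Z}^\star$ for all neighborhoods $U$ of $\ell$, and statistically convergent if this holds for some $\ell \in X$. A subsequence $(x_{n_k})$, with $(n_k)_{k \in \omega}$ strictly increasing, is regarded as a sequence indexed by $k \in \omega$; so it is statistically convergent to $\ell$ if $\{k : x_{n_k} \in U\} \in \mathcal{Z}^\star$ for all neighborhoods $U$ of $\ell$. "Convergent" means convergent in the ordinary sense to some point of $X$. *)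

theory Defs
  imports "HOL-Analysis.Analysis"
begin

text \<open>
  Sequences are indexed by the positive integers. They are represented by functions
  on \<^typ>\<open>nat\<close>; the value at \<open>0\<close> is never constrained and plays no role.
\<close>

abbreviation pos_nats :: "nat set" where
  "pos_nats \<equiv> {1..}"

text \<open>
  The quotient at \<open>n = 0\<close> is \<open>0 / 0 = 0\<close>, which does not affect the limit superior.
\<close>

definition upper_density :: "nat set \<Rightarrow> ereal" where
  "upper_density S = limsup (\<lambda>n. ereal (real (card (S \<inter> {1..n})) / real n))"

definition density_zero_ideal :: "nat set set" where
  "density_zero_ideal = {S. S \<subseteq> pos_nats \<and> upper_density S = 0}"

definition density_one_filter :: "nat set set" where
  "density_one_filter = {A. A \<subseteq> pos_nats \<and> pos_nats - A \<in> density_zero_ideal}"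

text \<open>Neighborhoods need not be open.\<close>

definition neighborhood_in :: "'a topology \<Rightarrow> 'a \<Rightarrow> 'a set \<Rightarrow> bool" where
  "neighborhood_in X l U \<longleftrightarrow> U \<subseteq> topspace X \<and> l \<in> X interior_of U"

definition stat_limitin :: "'a topology \<Rightarrow> (nat \<Rightarrow> 'a) \<Rightarrow> 'a \<Rightarrow> bool" where
  "stat_limitin X x l \<longleftrightarrow>
     l \<in> topspace X \<and>
     (\<forall>U. neighborhood_in X l U \<longrightarrow> {n \<in> pos_nats. x n \<in> U} \<in> density_one_filter)"

definition stat_convergent_in :: "'a topology \<Rightarrow> (nat \<Rightarrow> 'a) \<Rightarrow> bool" where
  "stat_convergent_in X x \<longleftrightarrow> (\<exists>l. stat_limitin X x l)"

definition convergent_in :: "'a topology \<Rightarrow> (nat \<Rightarrow> 'a) \<Rightarrow> bool" where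
  "convergent_in X x \<longleftrightarrow> (\<exists>l. limitin X x l sequentially)"

text \<open>
  A strictly increasing sequence of positive integers; the subsequence of \<open>x\<close> that it
  selects is \<open>x \<circ> r\<close>, and its set of indices is \<open>r ` pos_nats\<close>.
\<close>

definition index_seq :: "(nat \<Rightarrow> nat) \<Rightarrow> bool" where
  "index_seq r \<longleftrightarrow> r \<in> pos_nats \<rightarrow> pos_nats \<and> strict_mono_on pos_nats r"

end

theory Submission
  imports Defs
begin

text \<open>
  The equivalences rest on three properties of the ideal of sets of density zero.

  It is an ideal containing the finite sets. It is stable under the direct image by an
  index sequence \<open>r\<close>: since \<open>k \<le> r k\<close>, the set \<open>r ` B\<close> has at most as many elements up to
  \<open>n\<close> as \<open>B\<close> (\<open>density_zero_index_image\<close>). Hence a statistical limit of \<open>x \<circ> r\<close> along a set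
  \<open>r ` pos_nats\<close> of density one is a statistical limit of \<open>x\<close>: the indices \<open>n\<close> with
  \<open>x n \<notin> U\<close> are either outside the range of \<open>r\<close> or images of an exceptional set of \<open>x \<circ> r\<close>.
  The converse is witnessed by the identity.

  Finally it is a P-ideal: countably many sets of density zero are all contained, up to
  finite sets, in a single one (\<open>density_zero_P_ideal\<close>). If the limit \<open>l\<close> has a countable
  neighbourhood base, this is applied to the exceptional sets of the members of the base.
  Outside the resulting set the sequence lies in each member of the base with finitely many
  exceptions, so that enumerating the complement yields a convergent subsequence.
\<close>

section \<open>The ideal of sets of density zero\<close>

lemma density_zero_iff_tendsto:
  "S \<in> density_zero_ideal \<longleftrightarrow>
     S \<subseteq> pos_nats \<and> (\<lambda>n. real (card (S \<inter> {1..n})) / real n) \<longlonglongrightarrow> 0"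
proof -
  let ?f = "\<lambda>n. real (card (S \<inter> {1..n})) / real n"
  have "limsup (\<lambda>n. ereal (?f n)) = 0 \<longleftrightarrow> (\<lambda>n. ereal (?f n)) \<longlonglongrightarrow> 0"
  proof
    assume sup: "limsup (\<lambda>n. ereal (?f n)) = 0"
    have "0 \<le> liminf (\<lambda>n. ereal (?f n))"
      by (rule Liminf_bounded) simp
    moreover have "liminf (\<lambda>n. ereal (?f n)) \<le> limsup (\<lambda>n. ereal (?f n))"
      by (rule Liminf_le_Limsup) simp
    ultimately show "(\<lambda>n. ereal (?f n)) \<longlonglongrightarrow> 0"
      using sup by (simp add: tendsto_iff_Liminf_eq_Limsup)
  next
    assume "(\<lambda>n. ereal (?f n)) \<longlonglongrightarrow> 0"
    then show "limsup (\<lambda>n. ereal (?f n)) = 0"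
      by (rule lim_imp_Limsup[OF sequentially_bot])
  qed
  then show ?thesis
    by (simp add: density_zero_ideal_def upper_density_def zero_ereal_def)
qed

lemma density_zero_leI:
  assumes "T \<in> density_zero_ideal" and "S \<subseteq> pos_nats"
    and le: "\<And>n. card (S \<inter> {1..n}) \<le> card (T \<inter> {1..n})"
  shows "S \<in> density_zero_ideal"
proof -
  have lim: "(\<lambda>n. real (card (T \<inter> {1..n})) / real n) \<longlonglongrightarrow> 0"
    using assms(1) by (simp add: density_zero_iff_tendsto)
  have "(\<lambda>n. real (card (S \<inter> {1..n})) / real n) \<longlonglongrightarrow> 0"
    by (rule tendsto_sandwich[OF _ _ tendsto_const lim])
      (use le in \<open>auto intro!: always_eventually divide_right_mono\<close>)
  with assms(2) show ?thesis
    by (simp add: density_zero_iff_tendsto)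
qed

lemma density_zero_subset:
  assumes "T \<in> density_zero_ideal" and "S \<subseteq> T"
  shows "S \<in> density_zero_ideal"
proof (rule density_zero_leI[OF assms(1)])
  show "S \<subseteq> pos_nats"
    using assms by (auto simp: density_zero_iff_tendsto)
  show "card (S \<inter> {1..n}) \<le> card (T \<inter> {1..n})" for n
    using assms(2) by (intro card_mono) auto
qed

lemma density_zero_Un:
  assumes "S \<in> density_zero_ideal" and "T \<in> density_zero_ideal"
  shows "S \<union> T \<in> density_zero_ideal"
proof -
  have "(\<lambda>n. real (card (S \<inter> {1..n})) / real n + real (card (T \<inter> {1..n})) / real n)
          \<longlonglongrightarrow> 0 + 0"
    using assms by (intro tendsto_add) (simp_all add: density_zero_iff_tendsto)
  then have lim: "(\<lambda>n. (real (card (S \<inter> {1..n})) + real (card (T \<inter> {1..n}))) / real n)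
          \<longlonglongrightarrow> 0"
    by (simp add: add_divide_distrib)
  have "real (card ((S \<union> T) \<inter> {1..n})) \<le> real (card (S \<inter> {1..n})) + real (card (T \<inter> {1..n}))"
    for n
    using card_Un_le[of "S \<inter> {1..n}" "T \<inter> {1..n}"] by (simp add: Int_Un_distrib2)
  then have "(\<lambda>n. real (card ((S \<union> T) \<inter> {1..n})) / real n) \<longlonglongrightarrow> 0"
    by (intro tendsto_sandwich[OF _ _ tendsto_const lim])
      (auto intro!: always_eventually divide_right_mono)
  with assms show ?thesis
    by (simp add: density_zero_iff_tendsto)
qed

lemma finite_density_zero:
  assumes "finite S" and "S \<subseteq> pos_nats"
  shows "S \<in> density_zero_ideal"
proof -
  have "(\<lambda>n. real (card (S \<inter> {1..n})) / real n) \<longlonglongrightarrow> 0"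
    by (rule tendsto_sandwich[OF _ _ tendsto_const lim_const_over_n[of "real (card S)"]])
      (auto intro!: always_eventually divide_right_mono card_mono assms)
  with assms show ?thesis
    by (simp add: density_zero_iff_tendsto)
qed

lemma density_zero_UN:
  assumes "finite I" and "\<And>i. i \<in> I \<Longrightarrow> B i \<in> density_zero_ideal"
  shows "(\<Union>i\<in>I. B i) \<in> density_zero_ideal"
  using assms by (induction I) (simp_all add: finite_density_zero density_zero_Un)

lemma pos_nats_not_density_zero: "pos_nats \<notin> density_zero_ideal"
proof
  assume "pos_nats \<in> density_zero_ideal"
  then have "(\<lambda>n. real (card (pos_nats \<inter> {1..n})) / real n) \<longlonglongrightarrow> 0"
    by (simp add: density_zero_iff_tendsto)
  moreover have "pos_nats \<inter> {1..n} = {1..n}" for n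
    by auto
  then have "\<forall>\<^sub>F n in sequentially. real (card (pos_nats \<inter> {1..n})) / real n = 1"
    using eventually_gt_at_top[of 0] by (auto elim: eventually_mono)
  then have "(\<lambda>n. real (card (pos_nats \<inter> {1..n})) / real n) \<longlonglongrightarrow> 1"
    by (rule tendsto_eventually)
  ultimately show False
    using LIMSEQ_unique zero_neq_one by blast
qed

lemma density_one_infinite:
  assumes "A \<in> density_one_filter"
  shows "infinite A"
proof
  assume "finite A"
  then have "A \<union> (pos_nats - A) \<in> density_zero_ideal"
    using assms unfolding density_one_filter_def
    by (blast intro: density_zero_Un finite_density_zero)
  moreover have "A \<union> (pos_nats - A) = pos_nats"
    using assms by (auto simp: density_one_filter_def)
  ultimately show False
    using pos_nats_not_density_zero by simp
qed

text \<open>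
  Statistical limits are handled through their exceptional sets, because unions, images and
  the P-ideal property concern the ideal rather than the filter.
\<close>

lemma Collect_density_one_iff:
  "{n \<in> pos_nats. P n} \<in> density_one_filter \<longleftrightarrow> {n \<in> pos_nats. \<not> P n} \<in> density_zero_ideal"
proof -
  have "pos_nats - {n \<in> pos_nats. P n} = {n \<in> pos_nats. \<not> P n}"
    by auto
  then show ?thesis
    by (auto simp: density_one_filter_def)
qed

text \<open>
  Replacing \<open>B j\<close> by \<open>B 0 \<union> \<dots> \<union> B j\<close>, the sets may be taken increasing. Choose thresholds
  \<open>N j\<close>, increasing to infinity, past which the relative frequency of \<open>B j\<close> stays below
  \<open>1 / (j + 1)\<close>, and let \<open>B j\<close> contribute only its elements beyond \<open>N j\<close>. Up to \<open>n\<close>, the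
  union of these tails is then contained in the single set \<open>B j\<close> for the last \<open>j\<close> with
  \<open>N j \<le> n\<close>, and that \<open>j\<close> tends to infinity with \<open>n\<close>.
\<close>

lemma density_zero_P_ideal:
  fixes B :: "nat \<Rightarrow> nat set"
  assumes B: "\<And>j. B j \<in> density_zero_ideal"
  obtains D where "D \<in> density_zero_ideal" and "\<forall>j. finite (B j - D)"
proof -
  define C where "C j = (\<Union>i\<le>j. B i)" for j
  have C: "C j \<in> density_zero_ideal" for j
    unfolding C_def by (rule density_zero_UN) (simp_all add: B)
  have C_mono: "C i \<subseteq> C j" if "i \<le> j" for i j
    using that by (force simp: C_def)
  have "\<exists>M. \<forall>n\<ge>M. real (card (C j \<inter> {1..n})) / real n < 1 / real (Suc j)" for j
  proof -
    have "\<forall>\<^sub>F n in sequentially. real (card (C j \<inter> {1..n})) / real n < 1 / real (Suc j)"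
      using C[of j] by (intro order_tendstoD(2)[of _ 0]) (simp_all add: density_zero_iff_tendsto)
    then show ?thesis
      by (simp add: eventually_sequentially)
  qed
  then obtain M where M: "\<And>j n. M j \<le> n \<Longrightarrow> real (card (C j \<inter> {1..n})) / real n < 1 / real (Suc j)"
    by metis
  define N where "N j = j + (\<Sum>i\<le>j. M i)" for j
  have N_ge: "j \<le> N j" "M j \<le> N j" for j
    using member_le_sum[of j "{..j}" M] by (auto simp: N_def)
  define D where "D = (\<Union>j. C j \<inter> {N j..})"
  have freq: "real (card (D \<inter> {1..n})) / real n \<le> 1 / real (Suc J)" if n: "N J \<le> n" for J n
  proof -
    define j where "j = Max {i. N i \<le> n}"
    have "{i. N i \<le> n} \<subseteq> {..n}"
      using N_ge(1) by (auto intro: order_trans)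
    then have fin: "finite {i. N i \<le> n}"
      by (rule finite_subset) simp
    then have j: "N j \<le> n" and J: "J \<le> j" and last: "\<And>i. N i \<le> n \<Longrightarrow> i \<le> j"
      using Max_in[OF fin] n by (auto simp: j_def)
    have "D \<inter> {1..n} \<subseteq> C j \<inter> {1..n}"
    proof
      fix m assume m: "m \<in> D \<inter> {1..n}"
      then obtain i where "m \<in> C i" "N i \<le> m"
        by (auto simp: D_def)
      moreover from this m have "i \<le> j"
        by (intro last) simp
      ultimately show "m \<in> C j \<inter> {1..n}"
        using C_mono m by blast
    qed
    then have "real (card (D \<inter> {1..n})) / real n \<le> real (card (C j \<inter> {1..n})) / real n"
      by (intro divide_right_mono) (simp_all add: card_mono)
    also have "\<dots> \<le> 1 / real (Suc j)"
      using M[of j n] N_ge(2)[of j] j by simp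
    also have "\<dots> \<le> 1 / real (Suc J)"
      using J by (simp add: frac_le)
    finally show ?thesis .
  qed
  have "(\<lambda>n. real (card (D \<inter> {1..n})) / real n) \<longlonglongrightarrow> 0"
  proof (rule LIMSEQ_I)
    fix e :: real assume "0 < e"
    then obtain J where J: "1 / real (Suc J) < e"
      using nat_approx_posE by blast
    show "\<exists>K. \<forall>n\<ge>K. norm (real (card (D \<inter> {1..n})) / real n - 0) < e"
      using freq[of J] J by (intro exI[of _ "N J"]) (fastforce simp: abs_of_nonneg)
  qed
  moreover have "D \<subseteq> pos_nats"
    using C by (force simp: D_def density_zero_iff_tendsto)
  ultimately have "D \<in> density_zero_ideal"
    by (simp add: density_zero_iff_tendsto)
  moreover have "finite (B j - D)" for j
  proof (rule finite_subset)
    show "B j - D \<subseteq> {..<N j}"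
      by (auto simp: D_def C_def not_le[symmetric])
  qed simp
  ultimately show thesis
    using that by blast
qed

section \<open>Index sequences\<close>

lemma index_seq_pos: "index_seq r \<Longrightarrow> 1 \<le> k \<Longrightarrow> 1 \<le> r k"
  by (auto simp: index_seq_def Pi_iff)

lemma index_seq_less: "index_seq r \<Longrightarrow> 1 \<le> j \<Longrightarrow> j < k \<Longrightarrow> r j < r k"
  by (auto simp: index_seq_def strict_mono_on_def)

lemma index_seq_ge:
  assumes "index_seq r" and "1 \<le> k"
  shows "k \<le> r k"
  using assms(2)
proof (induction k rule: dec_induct)
  case base
  show ?case
    using index_seq_pos[OF assms(1)] by simp
next
  case (step k)
  then show ?case
    using index_seq_less[OF assms(1), of k "Suc k"] by simp
qed

text \<open>
  An index sequence never moves an index downwards, so it can only lower the counting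
  function.
\<close>

lemma density_zero_index_image:
  assumes r: "index_seq r" and B: "B \<in> density_zero_ideal"
  shows "r ` B \<in> density_zero_ideal"
proof (rule density_zero_leI[OF B])
  have pos: "B \<subseteq> pos_nats"
    using B by (simp add: density_zero_iff_tendsto)
  then show "r ` B \<subseteq> pos_nats"
    using index_seq_pos[OF r] by auto
  show "card (r ` B \<inter> {1..n}) \<le> card (B \<inter> {1..n})" for n
  proof -
    have "k \<in> {1..n}" if "k \<in> B" "r k \<le> n" for k
      using that pos index_seq_ge[OF r, of k] by auto
    then have "r ` B \<inter> {1..n} \<subseteq> r ` (B \<inter> {1..n})"
      by auto
    then show ?thesis
      by (rule surj_card_le[rotated]) simp
  qed
qed

lemma index_seq_enumerating:
  assumes "infinite A" and "A \<subseteq> pos_nats"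
  obtains r where "index_seq r" and "r ` pos_nats = A"
proof
  \<comment> \<open>The library enumeration starts at index \<open>0\<close>.\<close>
  define r where "r k = enumerate A (k - 1)" for k
  have "r ` pos_nats = range (enumerate A)"
  proof
    show "range (enumerate A) \<subseteq> r ` pos_nats"
    proof
      fix a assume "a \<in> range (enumerate A)"
      then obtain i where "a = r (Suc i)"
        by (auto simp: r_def)
      then show "a \<in> r ` pos_nats"
        by auto
    qed
  qed (auto simp: r_def)
  then show img: "r ` pos_nats = A"
    using range_enumerate[OF assms(1)] by simp
  show "index_seq r"
    unfolding index_seq_def
  proof
    show "r \<in> pos_nats \<rightarrow> pos_nats"
      using img assms(2) by blast
    show "strict_mono_on pos_nats r"
      by (auto simp: strict_mono_on_def r_def enumerate_mono assms(1) diff_less_mono)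
  qed
qed

section \<open>Statistical limits and subsequences\<close>

lemma stat_limitin_iff_openin:
  "stat_limitin X x l \<longleftrightarrow>
     l \<in> topspace X \<and>
     (\<forall>U. openin X U \<longrightarrow> l \<in> U \<longrightarrow> {n \<in> pos_nats. x n \<notin> U} \<in> density_zero_ideal)"
proof -
  have "(\<forall>U. neighborhood_in X l U \<longrightarrow> {n \<in> pos_nats. x n \<notin> U} \<in> density_zero_ideal) \<longleftrightarrow>
        (\<forall>U. openin X U \<longrightarrow> l \<in> U \<longrightarrow> {n \<in> pos_nats. x n \<notin> U} \<in> density_zero_ideal)"
    (is "?nbhd \<longleftrightarrow> ?open")
  proof
    assume nbhd: ?nbhd
    show ?open
    proof (intro allI impI)
      fix U assume "openin X U" "l \<in> U"
      then have "neighborhood_in X l U"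
        by (simp add: neighborhood_in_def interior_of_openin openin_subset)
      with nbhd show "{n \<in> pos_nats. x n \<notin> U} \<in> density_zero_ideal"
        by blast
    qed
  next
    assume op: ?open
    show ?nbhd
    proof (intro allI impI)
      fix U assume "neighborhood_in X l U"
      then have "l \<in> X interior_of U"
        by (simp add: neighborhood_in_def)
      with op have "{n \<in> pos_nats. x n \<notin> X interior_of U} \<in> density_zero_ideal"
        by simp
      then show "{n \<in> pos_nats. x n \<notin> U} \<in> density_zero_ideal"
        by (rule density_zero_subset) (use interior_of_subset in fastforce)
    qed
  qed
  then show ?thesis
    unfolding stat_limitin_def Collect_density_one_iff by (rule arg_cong)
qed

lemma limitin_imp_stat_limitin:
  assumes "limitin X x l sequentially"
  shows "stat_limitin X x l"
  unfolding stat_limitin_iff_openin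
proof (intro conjI allI impI)
  show "l \<in> topspace X"
    using assms by (rule limitin_topspace)
  fix U assume "openin X U" "l \<in> U"
  then obtain K where K: "\<And>n. K \<le> n \<Longrightarrow> x n \<in> U"
    using assms by (auto simp: limitin_sequentially)
  have "{n \<in> pos_nats. x n \<notin> U} \<subseteq> {..<K}"
    using K by (auto simp: not_le[symmetric])
  then show "{n \<in> pos_nats. x n \<notin> U} \<in> density_zero_ideal"
    by (intro finite_density_zero) (auto intro: finite_subset)
qed

text \<open>
  An exceptional index for \<open>x\<close> is either missed by \<open>r\<close> or the image of an exceptional index
  for \<open>x \<circ> r\<close>, and both kinds have density zero.
\<close>

lemma stat_limitin_from_subsequence:
  assumes r: "index_seq r" and lim: "stat_limitin X (x \<circ> r) l"
    and range: "r ` pos_nats \<in> density_one_filter"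
  shows "stat_limitin X x l"
  unfolding stat_limitin_iff_openin
proof (intro conjI allI impI)
  show "l \<in> topspace X"
    using lim by (simp add: stat_limitin_def)
  fix U assume "openin X U" "l \<in> U"
  then have "{k \<in> pos_nats. (x \<circ> r) k \<notin> U} \<in> density_zero_ideal"
    using lim by (simp add: stat_limitin_iff_openin)
  then have "(pos_nats - r ` pos_nats) \<union> r ` {k \<in> pos_nats. (x \<circ> r) k \<notin> U}
               \<in> density_zero_ideal"
    using range
    by (intro density_zero_Un density_zero_index_image r) (auto simp: density_one_filter_def)
  then show "{n \<in> pos_nats. x n \<notin> U} \<in> density_zero_ideal"
    by (rule density_zero_subset) auto
qed

text \<open>
  The exceptional sets of a countable neighbourhood base at \<open>l\<close> are almost contained in a
  single set \<open>D\<close> of density zero, and the subsequence enumerates the indices outside \<open>D\<close>.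
\<close>

lemma convergent_subsequence_of_stat_limitin:
  assumes "first_countable X" and lim: "stat_limitin X x l"
  obtains r where "index_seq r" and "limitin X (x \<circ> r) l sequentially"
    and "r ` pos_nats \<in> density_one_filter"
proof -
  have l: "l \<in> topspace X"
    using lim by (simp add: stat_limitin_def)
  then obtain \<B> where "countable \<B>" and op: "\<And>V. V \<in> \<B> \<Longrightarrow> openin X V"
    and base: "\<And>U. openin X U \<Longrightarrow> l \<in> U \<Longrightarrow> \<exists>V\<in>\<B>. l \<in> V \<and> V \<subseteq> U"
    using assms(1) unfolding first_countable_def by metis
  define \<V> where "\<V> = {V \<in> \<B>. l \<in> V}"
  have "\<V> \<noteq> {}"
    using base[of "topspace X"] l by (auto simp: \<V>_def)
  moreover have "countable \<V>"
    using \<open>countable \<B>\<close> by (simp add: \<V>_def)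
  ultimately obtain V :: "nat \<Rightarrow> 'a set" where V: "range V = \<V>"
    by (rule that[OF range_from_nat_into])
  have V_open: "openin X (V j)" and V_mem: "l \<in> V j" for j
    using V op by (auto simp: \<V>_def)
  have "{n \<in> pos_nats. x n \<notin> V j} \<in> density_zero_ideal" for j
    using lim V_open V_mem by (simp add: stat_limitin_iff_openin)
  then obtain D where D: "D \<in> density_zero_ideal"
    and almost: "\<forall>j. finite ({n \<in> pos_nats. x n \<notin> V j} - D)"
    by (rule density_zero_P_ideal[where B = "\<lambda>j. {n \<in> pos_nats. x n \<notin> V j}"])
  have "pos_nats - (pos_nats - D) = D"
    using D by (auto simp: density_zero_iff_tendsto)
  then have A: "pos_nats - D \<in> density_one_filter"
    using D by (simp add: density_one_filter_def)
  then obtain r where r: "index_seq r" and img: "r ` pos_nats = pos_nats - D"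
    by (rule index_seq_enumerating[OF density_one_infinite Diff_subset])
  have "limitin X (x \<circ> r) l sequentially"
    unfolding limitin_def
  proof (intro conjI allI impI l)
    fix U assume U: "openin X U \<and> l \<in> U"
    then have "\<exists>W\<in>\<V>. W \<subseteq> U"
      using base unfolding \<V>_def by blast
    then obtain j where j: "V j \<subseteq> U"
      using V by auto
    obtain K where K: "\<And>n. n \<in> pos_nats - D \<Longrightarrow> x n \<notin> V j \<Longrightarrow> n < K"
      using almost[rule_format, of j] by (auto simp: finite_nat_set_iff_bounded)
    have "(x \<circ> r) k \<in> U" if "k \<ge> max 1 K" for k
    proof -
      from that have k: "1 \<le> k" "K \<le> k"
        by auto
      then have "r k \<in> pos_nats - D"
        using img by auto
      moreover have "\<not> r k < K"
        using index_seq_ge[OF r k(1)] k(2) by simp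
      ultimately show ?thesis
        using K[of "r k"] j by auto
    qed
    then show "\<forall>\<^sub>F k in sequentially. (x \<circ> r) k \<in> U"
      unfolding eventually_sequentially by blast
  qed
  with r img A that show thesis
    by simp
qed

theorem corollary2p5:
  fixes X :: "'a topology" and x :: "nat \<Rightarrow> 'a"
  assumes "x \<in> pos_nats \<rightarrow> topspace X"
  shows "(stat_convergent_in X x \<longleftrightarrow>
            (\<exists>r. index_seq r \<and> stat_convergent_in X (x \<circ> r) \<and>
                 r ` pos_nats \<in> density_one_filter)) \<and>
         (first_countable X \<longrightarrow>
           (stat_convergent_in X x \<longleftrightarrow>
            (\<exists>r. index_seq r \<and> convergent_in X (x \<circ> r) \<and>
                 r ` pos_nats \<in> density_one_filter)))"
proof (intro conjI impI iffI)
  assume "stat_convergent_in X x"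
  moreover have "index_seq id"
    by (simp add: index_seq_def strict_mono_on_def)
  moreover have "id ` pos_nats \<in> density_one_filter"
    using finite_density_zero[of "{}"] by (simp add: density_one_filter_def)
  ultimately show "\<exists>r. index_seq r \<and> stat_convergent_in X (x \<circ> r) \<and>
                       r ` pos_nats \<in> density_one_filter"
    by (intro exI[of _ id]) simp
next
  assume "\<exists>r. index_seq r \<and> stat_convergent_in X (x \<circ> r) \<and>
              r ` pos_nats \<in> density_one_filter"
  then show "stat_convergent_in X x"
    unfolding stat_convergent_in_def by (blast intro: stat_limitin_from_subsequence)
next
  assume "first_countable X" and "stat_convergent_in X x"
  then show "\<exists>r. index_seq r \<and> convergent_in X (x \<circ> r) \<and>
                 r ` pos_nats \<in> density_one_filter"
    unfolding stat_convergent_in_def convergent_in_def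
    by (metis convergent_subsequence_of_stat_limitin)
next
  assume "\<exists>r. index_seq r \<and> convergent_in X (x \<circ> r) \<and>
              r ` pos_nats \<in> density_one_filter"
  then show "stat_convergent_in X x"
    unfolding stat_convergent_in_def convergent_in_def
    by (blast intro: stat_limitin_from_subsequence limitin_imp_stat_limitin)
qed

end
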